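(* Let $N=\prod_{i=1}^a p_i^{n_i}$ be the prime factorization of $N$ (with $p_1,\dots,p_a$ distinct primes and $n_i>0$). Then $$a-1\leq \dim_{TH}(\Gamma(\mathbb{Z}_N))\leq a.$$
   Context: $\mathbb{Z}_N$ is the ring of integers modulo $N$. For a commutative ring $R$, $Z(R)=\{x\in R\setminus\{0\} : \exists\, y\in R\setminus\{0\} \text{ with } xy=0\}$ is the set of (nonzero) zero divisors. The zero divisor graph $\Gamma(R)$ is the simple graph with vertex set $Z(R)$ in which two distinct vertices $x,y$ are adjacent if and only if $xy=0$ in $R$. A graph $G$ is a threshold graph if there are a real number $S$ and real weights $a_v$ ($v\in V(G)$) such that distinct vertices $v,w$ are adjacent if and only if $a_v+a_w\geq S$. The threshold dimension $\dim_{TH}(G)$ of a graph $G$ is the minimum $k$ such that there exist threshold graphs $G_1,\dots,G_k$ on the vertex set $V(G)$ with $E(G_1)\cap\cdots\cap E(G_k)=E(G)$. *)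

theory Defs
  imports Complex_Main "HOL-Number_Theory.Residues"
begin

text \<open>A simple graph is a pair of a vertex set and a set of two-element sets of vertices.\<close>

type_synonym 'a sgraph = "'a set \<times> 'a set set"

abbreviation verts :: "'a sgraph \<Rightarrow> 'a set" where "verts G \<equiv> fst G"

abbreviation edges :: "'a sgraph \<Rightarrow> 'a set set" where "edges G \<equiv> snd G"

definition vertex_pairs :: "'a set \<Rightarrow> 'a set set" where
  "vertex_pairs V = {{u, v} | u v. u \<in> V \<and> v \<in> V \<and> u \<noteq> v}"

definition simple_graph :: "'a sgraph \<Rightarrow> bool" where
  "simple_graph G \<longleftrightarrow> edges G \<subseteq> vertex_pairs (verts G)"

definition threshold_graph :: "'a sgraph \<Rightarrow> bool" where
  "threshold_graph G \<longleftrightarrow> simple_graph G \<and>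
     (\<exists>(S::real) (w :: 'a \<Rightarrow> real). \<forall>u\<in>verts G. \<forall>v\<in>verts G.
        u \<noteq> v \<longrightarrow> ({u, v} \<in> edges G \<longleftrightarrow> w u + w v \<ge> S))"

definition threshold_representable :: "'a sgraph \<Rightarrow> nat \<Rightarrow> bool" where
  "threshold_representable G k \<longleftrightarrow>
     (\<exists>H :: nat \<Rightarrow> 'a sgraph.
        (\<forall>i\<in>{1..k}. threshold_graph (H i) \<and> verts (H i) = verts G) \<and>
        vertex_pairs (verts G) \<inter> (\<Inter>i\<in>{1..k}. edges (H i)) = edges G)"

text \<open>
  Intersecting with the set of all vertex pairs changes nothing for \<open>k \<ge> 1\<close>; it fixes the
  meaning of the empty intersection (\<open>k = 0\<close>) as the complete graph, so that exactly the
  complete graphs, including the graph without vertices, have threshold dimension 0.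
  The minimum exists for every finite simple graph, by \<open>threshold_dim_attained\<close> below.
\<close>

definition threshold_dim :: "'a sgraph \<Rightarrow> nat" where
  "threshold_dim G = (LEAST k. threshold_representable G k)"

lemma threshold_dim_attained:
  assumes "finite (verts G)" "simple_graph G"
  shows "threshold_representable G (threshold_dim G)"
proof -
  let ?V = "verts G"
  let ?N = "vertex_pairs ?V - edges G"
  have "vertex_pairs ?V \<subseteq> Pow ?V" by (auto simp: vertex_pairs_def)
  then have fin: "finite ?N" using assms(1) by (meson finite_Diff finite_Pow_iff finite_subset)
  then obtain f where f: "bij_betw f {1..card ?N} ?N"
    using ex_bij_betw_nat_finite_1 by blast
  let ?H = "\<lambda>i. (?V, vertex_pairs ?V - {f i})"
  have thr: "threshold_graph (?V, vertex_pairs ?V - {e})" if eN: "e \<in> ?N" for e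
    unfolding threshold_graph_def simple_graph_def
  proof (intro conjI exI ballI impI)
    fix u v assume uv: "u \<in> verts (?V, vertex_pairs ?V - {e})"
      "v \<in> verts (?V, vertex_pairs ?V - {e})" "u \<noteq> v"
    obtain a b where ab: "e = {a, b}" "a \<noteq> b" using eN by (auto simp: vertex_pairs_def)
    have "{u, v} \<in> vertex_pairs ?V" using uv by (auto simp: vertex_pairs_def)
    moreover have "{u, v} = e \<longleftrightarrow> u \<in> e \<and> v \<in> e" using ab uv by auto
    ultimately show "({u, v} \<in> edges (?V, vertex_pairs ?V - {e})) =
      ((1::real) \<le> (if u \<in> e then 0 else 1) + (if v \<in> e then 0 else 1))" by auto
  qed auto
  have img: "f ` {1..card ?N} = ?N" using f by (simp add: bij_betw_def)
  have "threshold_representable G (card ?N)"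
    unfolding threshold_representable_def
  proof (intro exI conjI)
    show "\<forall>i\<in>{1..card ?N}. threshold_graph (?H i) \<and> verts (?H i) = ?V"
      using thr img by fastforce
    have "vertex_pairs ?V \<inter> (\<Inter>i\<in>{1..card ?N}. edges (?H i))
        = vertex_pairs ?V - f ` {1..card ?N}" by auto
    also have "\<dots> = edges G"
      unfolding img using assms(2) by (auto simp: simple_graph_def)
    finally show "vertex_pairs ?V \<inter> (\<Inter>i\<in>{1..card ?N}. edges (?H i)) = edges G" .
  qed
  then show ?thesis unfolding threshold_dim_def by (rule LeastI)
qed

definition zero_divisors :: "('a, 'b) ring_scheme \<Rightarrow> 'a set" where
  "zero_divisors R =
     {x \<in> carrier R - {\<zero>\<^bsub>R\<^esub>}. \<exists>y \<in> carrier R - {\<zero>\<^bsub>R\<^esub>}. x \<otimes>\<^bsub>R\<^esub> y = \<zero>\<^bsub>R\<^esub>}"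

definition zero_divisor_graph :: "('a, 'b) ring_scheme \<Rightarrow> 'a sgraph" where
  "zero_divisor_graph R =
     (zero_divisors R,
      {{x, y} | x y. x \<in> zero_divisors R \<and> y \<in> zero_divisors R \<and> x \<noteq> y \<and>
                     x \<otimes>\<^bsub>R\<^esub> y = \<zero>\<^bsub>R\<^esub>})"

end

theory Submission
  imports Defs
begin

text \<open>
  The upper bound comes from the \<open>p\<close>-adic valuations: \<open>p ^ n\<close> divides \<open>x * y\<close> iff the
  valuations of \<open>x\<close> and \<open>y\<close> add up to at least \<open>n\<close>, which is a threshold condition.

  For the lower bound, put \<open>q i = N / p i ^ n i\<close>. The vertices \<open>q i\<close> and \<open>- q i\<close> are not
  adjacent, and they are distinct unless \<open>p i ^ n i = 2\<close>, which excludes at most one \<open>i\<close>. For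
  \<open>i \<noteq> j\<close> the products of \<open>\<plusminus> q i\<close> and \<open>\<plusminus> q j\<close> vanish, so the non-edges at \<open>i\<close> and \<open>j\<close> lie on an
  alternating 4-cycle. A threshold graph has no alternating 4-cycle, hence these
  non-edges have to be removed by different threshold graphs.
\<close>

text \<open>The two edges bound the total weight of the four vertices below by \<open>2 * S\<close>,
  and the non-edge gives \<open>u\<close> and \<open>v\<close> together less than \<open>S\<close>,
  so \<open>x\<close> and \<open>y\<close> together exceed \<open>S\<close>.\<close>

lemma threshold_graph_no_alternating_4_cycle:
  assumes "threshold_graph G"
    and "{u, v, x, y} \<subseteq> verts G"
    and "u \<noteq> v" "x \<noteq> y" "u \<noteq> x" "v \<noteq> y"
    and "{u, x} \<in> edges G" "{v, y} \<in> edges G" "{u, v} \<notin> edges G"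
  shows "{x, y} \<in> edges G"
proof -
  obtain S :: real and w where w: "\<And>u v. u \<in> verts G \<Longrightarrow> v \<in> verts G \<Longrightarrow> u \<noteq> v \<Longrightarrow>
      {u, v} \<in> edges G \<longleftrightarrow> w u + w v \<ge> S"
    using assms(1) unfolding threshold_graph_def by blast
  show ?thesis
    using w[of u x] w[of v y] w[of u v] w[of x y] assms(2-) by simp
qed

text \<open>Assign to each non-edge \<open>{x i, y i}\<close> a threshold graph that misses it. If
  \<open>i\<close> and \<open>j\<close> shared one, the edges \<open>{x i, x j}\<close> and
  \<open>{y i, y j}\<close> would complete a forbidden alternating 4-cycle, so the assignment is
  injective.\<close>

lemma card_le_threshold_representable:
  assumes rep: "threshold_representable G k"
    and V: "\<And>i. i \<in> I \<Longrightarrow> x i \<in> verts G \<and> y i \<in> verts G \<and> x i \<noteq> y i"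
    and nonedge: "\<And>i. i \<in> I \<Longrightarrow> {x i, y i} \<notin> edges G"
    and edge: "\<And>i j. i \<in> I \<Longrightarrow> j \<in> I \<Longrightarrow> i \<noteq> j \<Longrightarrow> {x i, x j} \<in> edges G \<and> {y i, y j} \<in> edges G"
  shows "card I \<le> k"
proof -
  obtain H where H: "\<And>i. i \<in> {1..k} \<Longrightarrow> threshold_graph (H i) \<and> verts (H i) = verts G"
    and E: "vertex_pairs (verts G) \<inter> (\<Inter>i\<in>{1..k}. edges (H i)) = edges G"
    using rep unfolding threshold_representable_def by blast
  have "\<forall>i\<in>I. \<exists>c\<in>{1..k}. {x i, y i} \<notin> edges (H c)"
  proof
    fix i assume i: "i \<in> I"
    \<comment> \<open>As a vertex pair outside \<open>edges G\<close>, it can only be lost in the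
      intersection of the \<open>edges (H c)\<close>.\<close>
    have "{x i, y i} \<in> vertex_pairs (verts G)"
      using V[OF i] by (auto simp: vertex_pairs_def)
    then show "\<exists>c\<in>{1..k}. {x i, y i} \<notin> edges (H c)"
      using nonedge[OF i] E by blast
  qed
  then obtain c where c: "\<And>i. i \<in> I \<Longrightarrow> c i \<in> {1..k} \<and> {x i, y i} \<notin> edges (H (c i))"
    by metis
  have "inj_on c I"
  proof (rule inj_onI, rule ccontr)
    fix i j assume ij: "i \<in> I" "j \<in> I" "c i = c j" "i \<noteq> j"
    have pairs: "{x i, x j} \<in> vertex_pairs (verts G)" "{y i, y j} \<in> vertex_pairs (verts G)"
      and inH: "{x i, x j} \<in> edges (H (c i))" "{y i, y j} \<in> edges (H (c i))"
      using edge[OF ij(1,2,4)] E c[OF ij(1)] by blast+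
    have "x i \<noteq> x j" "y i \<noteq> y j"
      using pairs by (auto simp: vertex_pairs_def doubleton_eq_iff)
    moreover have "threshold_graph (H (c i))" "verts (H (c i)) = verts G"
      using H c[OF ij(1)] by auto
    ultimately have "{x j, y j} \<in> edges (H (c i))"
      using V[OF ij(1)] V[OF ij(2)] c[OF ij(1)] inH
      by (intro threshold_graph_no_alternating_4_cycle[of "H (c i)" "x i" "y i" "x j" "y j"]) auto
    then show False using c[OF ij(2)] ij(3) by simp
  qed
  moreover have "c ` I \<subseteq> {1..k}" using c by blast
  ultimately show ?thesis
    using card_inj_on_le[of c I "{1..k}"] by simp
qed

section \<open>The zero divisor graph of \<open>residue_ring m\<close> in terms of integer
  divisibility\<close>

lemma zero_divisors_residue_ring:
  "zero_divisors (residue_ring m) =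
     {x. 0 < x \<and> x < m \<and> (\<exists>y. 0 < y \<and> y < m \<and> m dvd x * y)}"
proof -
  have "carrier (residue_ring m) - {\<zero>\<^bsub>residue_ring m\<^esub>} = {x. 0 < x \<and> x < m}"
    by (auto simp: residue_ring_def)
  then show ?thesis
    by (simp add: zero_divisors_def Bex_def dvd_eq_mod_eq_0 conj_assoc)
      (simp add: residue_ring_def)
qed

lemma verts_zero_divisor_graph: "verts (zero_divisor_graph R) = zero_divisors R"
  by (simp add: zero_divisor_graph_def)

lemma edge_zero_divisor_graph_residue_ring:
  "{x, y} \<in> edges (zero_divisor_graph (residue_ring m)) \<longleftrightarrow>
     x \<in> zero_divisors (residue_ring m) \<and> y \<in> zero_divisors (residue_ring m) \<and>
     x \<noteq> y \<and> m dvd x * y"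
proof -
  have "u \<otimes>\<^bsub>residue_ring m\<^esub> v = \<zero>\<^bsub>residue_ring m\<^esub> \<longleftrightarrow> m dvd u * v" for u v
    by (simp add: residue_ring_def dvd_eq_mod_eq_0)
  then show ?thesis
    by (auto simp: zero_divisor_graph_def doubleton_eq_iff mult.commute)
qed

lemma simple_zero_divisor_graph: "simple_graph (zero_divisor_graph R)"
  by (auto simp: simple_graph_def zero_divisor_graph_def vertex_pairs_def)

lemma finite_zero_divisors_residue_ring: "finite (zero_divisors (residue_ring m))"
  by (rule finite_subset[of _ "{0..m}"]) (auto simp: zero_divisors_residue_ring)

section \<open>Divisibility by a product of pairwise coprime prime powers\<close>

lemma prod_coprime_dvd:
  fixes f :: "'a \<Rightarrow> 'b::semiring_gcd"
  assumes "finite A"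
    and "\<And>i. i \<in> A \<Longrightarrow> f i dvd z"
    and "\<And>i j. i \<in> A \<Longrightarrow> j \<in> A \<Longrightarrow> i \<noteq> j \<Longrightarrow> coprime (f i) (f j)"
  shows "prod f A dvd z"
  using assms
proof (induction A rule: finite_induct)
  case (insert i A)
  have "coprime (f i) (prod f A)"
    using insert.prems(2) insert.hyps by (intro prod_coprime_right) auto
  moreover have "prod f A dvd z" "f i dvd z"
    using insert by auto
  ultimately show ?case
    using insert.hyps by (simp add: divides_mult)
qed simp

context
  fixes a :: nat and p n :: "nat \<Rightarrow> nat"
  assumes prime: "\<And>i. i \<in> {1..a} \<Longrightarrow> prime (p i)"
    and inj: "inj_on p {1..a}"
    and pos: "\<And>i. i \<in> {1..a} \<Longrightarrow> n i > 0"
begin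

lemma coprime_prime_powers:
  assumes "i \<in> {1..a}" "j \<in> {1..a}" "i \<noteq> j"
  shows "coprime (int (p i ^ n i)) (int (p j ^ n j))"
proof -
  have "p i \<noteq> p j" using inj assms by (meson inj_onD)
  then have "coprime (p i) (p j)" using prime assms primes_coprime by blast
  then show ?thesis by (simp del: of_nat_power add: coprime_int_iff)
qed

lemma prime_power_gt_1: "i \<in> {1..a} \<Longrightarrow> int (p i ^ n i) > 1"
  using prime_gt_1_nat[OF prime] pos one_less_power[of "p i" "n i"] by fastforce

lemma prod_prime_powers_dvd_iff:
  "(\<Prod>i = 1..a. int (p i ^ n i)) dvd z \<longleftrightarrow> (\<forall>i\<in>{1..a}. int (p i ^ n i) dvd z)"
proof
  assume "(\<Prod>i = 1..a. int (p i ^ n i)) dvd z"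
  then show "\<forall>i\<in>{1..a}. int (p i ^ n i) dvd z"
    by (meson dvd_prodI dvd_trans finite_atLeastAtMost)
next
  assume "\<forall>i\<in>{1..a}. int (p i ^ n i) dvd z"
  then show "(\<Prod>i = 1..a. int (p i ^ n i)) dvd z"
    using coprime_prime_powers by (intro prod_coprime_dvd) auto
qed

lemma threshold_dim_upper:
  "threshold_dim (zero_divisor_graph (residue_ring (\<Prod>i = 1..a. int (p i ^ n i)))) \<le> a"
proof -
  define M where "M = (\<Prod>i = 1..a. int (p i ^ n i))"
  define Z where "Z = zero_divisors (residue_ring M)"
  \<comment> \<open>One graph per prime: divisibility by \<open>M\<close> is the conjunction of the
    divisibilities by the prime powers, so the edge sets intersect to that of the zero divisor
    graph.\<close>
  define H where
    "H = (\<lambda>i. (Z, {{x, y} | x y. x \<in> Z \<and> y \<in> Z \<and> x \<noteq> y \<and> int (p i ^ n i) dvd x * y}))"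
  have edge_H: "{x, y} \<in> edges (H i) \<longleftrightarrow> x \<in> Z \<and> y \<in> Z \<and> x \<noteq> y \<and> int (p i ^ n i) dvd x * y"
    for i x y by (auto simp: H_def doubleton_eq_iff mult.commute)
  have "threshold_graph (H i)" if i: "i \<in> {1..a}" for i
    unfolding threshold_graph_def
  proof (intro conjI exI ballI impI)
    show "simple_graph (H i)"
      by (auto simp: simple_graph_def H_def vertex_pairs_def)
    fix x y assume "x \<in> verts (H i)" "y \<in> verts (H i)" "x \<noteq> y"
    then have xy: "x \<in> Z" "y \<in> Z" "x \<noteq> y" by (auto simp: H_def)
    \<comment> \<open>By convention \<open>multiplicity\<close> is 0 at 0, although every power
      divides 0.\<close>
    then have nz: "x \<noteq> 0" "y \<noteq> 0" by (auto simp: Z_def zero_divisors_residue_ring)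
    have pr: "prime (int (p i))" using prime[OF i] by simp
    have "int (p i ^ n i) dvd x * y \<longleftrightarrow> n i \<le> multiplicity (int (p i)) (x * y)"
      using nz pr by (simp only: of_nat_power)
        (intro power_dvd_iff_le_multiplicity; auto dest: not_prime_unit)
    also have "\<dots> \<longleftrightarrow> n i \<le> multiplicity (int (p i)) x + multiplicity (int (p i)) y"
      using nz pr by (simp add: prime_elem_multiplicity_mult_distrib)
    \<comment> \<open>This fixes the schematic threshold as \<open>n i\<close> and the weight of a
      vertex as its multiplicity at \<open>p i\<close>.\<close>
    finally show "{x, y} \<in> edges (H i) \<longleftrightarrow>
        real (n i) \<le> real (multiplicity (int (p i)) x) + real (multiplicity (int (p i)) y)"
      using xy by (simp add: edge_H flip: of_nat_add)
  qed
  moreover have "vertex_pairs Z \<inter> (\<Inter>i\<in>{1..a}. edges (H i))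
      = edges (zero_divisor_graph (residue_ring M))"
  proof (rule Set.set_eqI)
    fix e
    show "e \<in> vertex_pairs Z \<inter> (\<Inter>i\<in>{1..a}. edges (H i)) \<longleftrightarrow>
      e \<in> edges (zero_divisor_graph (residue_ring M))"
    proof (cases "e \<in> vertex_pairs Z")
      case True
      then obtain x y where e: "e = {x, y}" "x \<in> Z" "y \<in> Z" "x \<noteq> y"
        by (auto simp: vertex_pairs_def)
      show ?thesis
        using True e prod_prime_powers_dvd_iff[of "x * y"]
        by (simp add: edge_H edge_zero_divisor_graph_residue_ring Z_def M_def)
    next
      case False
      then show ?thesis
        using simple_zero_divisor_graph[of "residue_ring M"]
        by (auto simp: simple_graph_def verts_zero_divisor_graph Z_def)
    qed
  qed
  ultimately have "threshold_representable (zero_divisor_graph (residue_ring M)) a"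
    unfolding threshold_representable_def verts_zero_divisor_graph
    by (intro exI[of _ H]) (auto simp: H_def Z_def)
  then show ?thesis unfolding threshold_dim_def M_def by (rule Least_le)
qed

text \<open>A prime power equal to 2 has base 2, and \<open>p\<close> is injective. This possible
  loss of one index is why the lower bound is \<open>a - 1\<close> and not \<open>a\<close>.\<close>

lemma card_prime_power_neq_2: "a - 1 \<le> card {i \<in> {1..a}. int (p i ^ n i) \<noteq> 2}"
proof -
  let ?I = "{i \<in> {1..a}. int (p i ^ n i) \<noteq> 2}" and ?J = "{i \<in> {1..a}. int (p i ^ n i) = 2}"
  have two: "p i = 2" if "i \<in> ?J" for i
  proof -
    have "p i ^ n i = 2" using that by (simp flip: of_nat_power)
    then have "p i dvd 2" using that pos[of i] dvd_power[of "n i" "p i"] by auto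
    then show ?thesis using that prime[of i] primes_dvd_imp_eq two_is_prime_nat by blast
  qed
  have "\<forall>i\<in>?J. \<forall>j\<in>?J. i = j"
    using two inj unfolding inj_on_def by (metis (no_types, lifting) mem_Collect_eq)
  then have "card ?J \<le> 1"
    by (simp add: card_le_Suc0_iff_eq)
  moreover have "card ?I + card ?J = card (?I \<union> ?J)"
    by (rule card_Un_disjoint[symmetric]) auto
  moreover have "?I \<union> ?J = {1..a}" by auto
  ultimately show ?thesis by simp
qed

lemma threshold_dim_lower:
  "a - 1 \<le> threshold_dim (zero_divisor_graph (residue_ring (\<Prod>i = 1..a. int (p i ^ n i))))"
\<comment> \<open>For \<open>a \<le> 1\<close> the truncated difference is 0. Otherwise a second
  prime exists, which makes every \<open>q i\<close> exceed 1.\<close>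
proof (cases "a \<le> 1")
  case False
  define P where "P = (\<lambda>i. int (p i ^ n i))"
  define M where "M = (\<Prod>i = 1..a. P i)"
  \<comment> \<open>For \<open>i\<close> in range this is \<open>M\<close> divided by
    \<open>P i\<close>, kept as a product so that its divisors and its coprimality to
    \<open>P i\<close> can be read off.\<close>
  define q where "q = (\<lambda>i. \<Prod>j\<in>{1..a} - {i}. P j)"
  define Z where "Z = zero_divisors (residue_ring M)"
  define I where "I = {i \<in> {1..a}. P i \<noteq> 2}"
  let ?G = "zero_divisor_graph (residue_ring M)"
  have P_gt: "P i > 1" if "i \<in> {1..a}" for i
    using prime_power_gt_1[OF that] by (simp add: P_def)
  have M_eq: "M = P i * q i" if "i \<in> {1..a}" for i
    unfolding M_def q_def using that by (intro prod.remove) auto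
  have q_pos: "q i > 0" for i
    unfolding q_def using P_gt by (intro prod_pos) force
  have P_dvd_q: "P j dvd q i" if "j \<in> {1..a}" "i \<noteq> j" for i j
    unfolding q_def using that by (intro dvd_prodI) auto
  have M_dvd: "M dvd q i * q j" if "i \<in> {1..a}" "j \<in> {1..a}" "i \<noteq> j" for i j
    using M_eq[OF that(1)] P_dvd_q[of i j] that by (simp add: mult_dvd_mono mult.commute)
  have q_gt: "q i > 1" if i: "i \<in> {1..a}" for i
  proof -
    obtain j where j: "j \<in> {1..a}" "i \<noteq> j"
      using False i that by (metis atLeastAtMost_iff le_refl nat_le_linear)
    show ?thesis using zdvd_imp_le[OF P_dvd_q[OF j] q_pos] P_gt[OF j(1)] by linarith
  qed
  have q_less: "q i < M" "P i < M" if "i \<in> {1..a}" for i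
    using M_eq[OF that] P_gt[OF that] q_gt[OF that] by auto
  have not_dvd: "\<not> M dvd q i * q i" if i: "i \<in> {1..a}" for i
  proof
    assume "M dvd q i * q i"
    then have "P i dvd q i" using M_eq[OF i] q_pos[of i] by simp
    moreover have "coprime (P i) (q i)"
      unfolding q_def P_def using i by (intro prod_coprime_right coprime_prime_powers) auto
    ultimately show False using P_gt[OF i] coprime_absorb_left by fastforce
  qed
  \<comment> \<open>\<open>M - q i\<close> is the representative of \<open>- q i\<close> in the
    carrier. Both are annihilated by \<open>P i\<close>, which is a nonzero residue because
    \<open>q i > 1\<close> forces \<open>P i < M\<close>.\<close>
  have q_Z: "q i \<in> Z" "M - q i \<in> Z" if i: "i \<in> {1..a}" for i
  proof -
    have "M dvd q i * P i" "M dvd (M - q i) * P i"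
      using M_eq[OF i] by (simp_all add: algebra_simps)
    then show "q i \<in> Z" "M - q i \<in> Z"
      unfolding Z_def zero_divisors_residue_ring
      using q_less[OF i] P_gt[OF i] q_pos[of i] by (auto intro!: exI[of _ "P i"])
  qed
  have q_neq: "q i \<noteq> q j" if "i \<in> {1..a}" "j \<in> {1..a}" "i \<noteq> j" for i j
    using M_dvd[OF that] not_dvd[OF that(1)] by auto
  have "threshold_representable ?G (threshold_dim ?G)"
    by (intro threshold_dim_attained simple_zero_divisor_graph)
      (simp add: verts_zero_divisor_graph finite_zero_divisors_residue_ring)
  then have "card I \<le> threshold_dim ?G"
  proof (rule card_le_threshold_representable)
    fix i assume i: "i \<in> I"
    then have i': "i \<in> {1..a}" "P i \<noteq> 2" by (auto simp: I_def)
    \<comment> \<open>Equality would give \<open>P i * q i = 2 * q i\<close>, hence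
      \<open>P i = 2\<close>.\<close>
    then have "q i \<noteq> M - q i" using M_eq[of i] q_pos[of i] by auto
    then show "q i \<in> verts ?G \<and> M - q i \<in> verts ?G \<and> q i \<noteq> M - q i"
      using q_Z[OF i'(1)] by (simp add: verts_zero_divisor_graph Z_def)
    have "q i * (M - q i) = M * q i - q i * q i" by (simp add: algebra_simps)
    then have "\<not> M dvd q i * (M - q i)"
      using not_dvd[OF i'(1)] by (metis dvd_diff_right_iff dvd_triv_left)
    then show "{q i, M - q i} \<notin> edges ?G"
      by (simp add: edge_zero_divisor_graph_residue_ring)
  next
    fix i j assume "i \<in> I" "j \<in> I" "i \<noteq> j"
    then have ij: "i \<in> {1..a}" "j \<in> {1..a}" "i \<noteq> j" by (auto simp: I_def)
    have "(M - q i) * (M - q j) = M * (M - q i - q j) + q i * q j"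
      by (simp add: algebra_simps)
    then have "M dvd (M - q i) * (M - q j)" using M_dvd[OF ij] by simp
    then show "{q i, q j} \<in> edges ?G \<and> {M - q i, M - q j} \<in> edges ?G"
      using q_Z[OF ij(1)] q_Z[OF ij(2)] q_neq[OF ij] M_dvd[OF ij]
      by (simp add: edge_zero_divisor_graph_residue_ring Z_def)
  qed
  then show ?thesis
    using card_prime_power_neq_2 unfolding I_def M_def P_def by linarith
qed simp

end

theorem theorem2p8:
  fixes N a :: nat and p n :: "nat \<Rightarrow> nat"
  assumes "\<And>i. i \<in> {1..a} \<Longrightarrow> prime (p i)"
    and "inj_on p {1..a}"
    and "\<And>i. i \<in> {1..a} \<Longrightarrow> n i > 0"
    and "N = (\<Prod>i = 1..a. p i ^ n i)"
  shows "int a - 1 \<le> int (threshold_dim (zero_divisor_graph (residue_ring (int N))))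
       \<and> threshold_dim (zero_divisor_graph (residue_ring (int N))) \<le> a"
proof -
  have N: "int N = (\<Prod>i = 1..a. int (p i ^ n i))"
    using assms(4) by simp
  \<comment> \<open>The truncated \<open>a - 1\<close> of \<open>threshold_dim_lower\<close> is
    never below the integer \<open>int a - 1\<close>; they differ only for
    \<open>a = 0\<close>.\<close>
  show ?thesis
    using threshold_dim_lower[of a p n] threshold_dim_upper[of a p n] assms(1-3)
    unfolding N by force
qed

end
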